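(* Let $\eta\in(0,1)$ and $\alpha\in(0,n)$. Then there exists a constant $C=C(n,\eta)>0$ such that the estimate $$\|f\|_{L^\infty}\leq C+C\|f\|_{BMO}\left(1+\log^+\left[\sup_{z\in \mathbb{R}^n}\int_{\mathbb{R}^n}\frac{|f(y)|}{(|z-y|+1)^\alpha}\,dy +\|f\|_{\dot{\mathcal{C}}^\eta}\right]\right)$$ holds for all $f\in \dot{\mathcal{C}}^{\eta}\cap BMO$.
   Context: Functions are defined on $\mathbb{R}^n$. The notation $\log^+ s$ means $\log s$ if $s\geq 1$ and $0$ if $s\in(0,1)$. For $\eta\in(0,1)$, $\dot{\mathcal{C}}^\eta$ is the homogeneous Hölder space of order $\eta$, endowed with the semi-norm $\|f\|_{\dot{\mathcal{C}}^\eta}=\sup_{x\neq y}\frac{|f(x)-f(y)|}{|x-y|^\eta}$. $BMO$ is the usual space of functions of bounded mean oscillation on $\mathbb{R}^n$, with semi-norm $\|f\|_{BMO}=\sup_B \frac{1}{|B|}\int_B|f-(f)_B|\,dx$, the supremum being over all balls $B\subset\mathbb{R}^n$, where $(f)_B=\frac1{|B|}\int_B f\,dx$.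
   Formalization: The constant C may depend on α as well as on n and η, since no constant independent of α works as α→n, and nonzero constant functions f, for which the right-hand side is the undefined product 0·∞, are excluded. *)

theory Defs
  imports "HOL-Analysis.Analysis" "HOL-Probability.Essential_Supremum"
begin

text \<open>All (semi-)norms take values in \<^typ>\<open>ennreal\<close>, so that the suprema and integrals are defined
  for every function and membership in a space is finiteness.\<close>

definition Linfty_norm :: "(real ^ 'n \<Rightarrow> real) \<Rightarrow> ennreal" where
  "Linfty_norm f = esssup lebesgue (\<lambda>x. ennreal \<bar>f x\<bar>)"

definition holder_seminorm :: "real \<Rightarrow> (real ^ 'n \<Rightarrow> real) \<Rightarrow> ennreal" where
  "holder_seminorm \<eta> f =
     (SUP (x, y) \<in> {(x, y). x \<noteq> y}. ennreal (\<bar>f x - f y\<bar> / norm (x - y) powr \<eta>))"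

definition holder_space :: "real \<Rightarrow> (real ^ 'n \<Rightarrow> real) set" where
  "holder_space \<eta> = {f. holder_seminorm \<eta> f < \<infinity>}"

definition mean_on :: "(real ^ 'n) set \<Rightarrow> (real ^ 'n \<Rightarrow> real) \<Rightarrow> real" where
  "mean_on B f = (LINT x:B|lebesgue. f x) / measure lebesgue B"

definition BMO_seminorm :: "(real ^ 'n \<Rightarrow> real) \<Rightarrow> ennreal" where
  "BMO_seminorm f =
     (SUP (c, r) \<in> {(c, r). r > 0}.
        (\<integral>\<^sup>+x\<in>ball c r. ennreal \<bar>f x - mean_on (ball c r) f\<bar> \<partial>lebesgue) / emeasure lebesgue (ball c r))"

text \<open>Integrability on every ball is local integrability; without it the Bochner mean
  \<^const>\<open>mean_on\<close> would silently be 0.\<close>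

definition BMO :: "(real ^ 'n \<Rightarrow> real) set" where
  "BMO = {f. (\<forall>c r. set_integrable lebesgue (ball c r) f) \<and> BMO_seminorm f < \<infinity>}"

text \<open>The value at 0 is fixed as 0, the limit from the right, and the value at infinity
  as infinity.\<close>

definition log_plus :: "ennreal \<Rightarrow> ennreal" where
  "log_plus s = (if s = \<infinity> then \<infinity> else if s \<ge> 1 then ennreal (ln (enn2real s)) else 0)"

definition weighted_sup :: "real \<Rightarrow> (real ^ 'n \<Rightarrow> real) \<Rightarrow> ennreal" where
  "weighted_sup \<alpha> f =
     (SUP z. \<integral>\<^sup>+y. ennreal (\<bar>f y\<bar> / (norm (z - y) + 1) powr \<alpha>) \<partial>lebesgue)"

text \<open>\<^const>\<open>weighted_sup\<close> may be infinite. In \<^typ>\<open>ennreal\<close> the product of 0 and infinity is 0, so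
  for a nonzero constant function, where \<^const>\<open>BMO_seminorm\<close> is 0 and \<^const>\<open>weighted_sup\<close> is
  infinite, a product of the two does not express an infinite (trivial) bound. An estimate involving
  this product is meaningful only away from that indeterminate case.\<close>

definition indeterminate_bound :: "real \<Rightarrow> (real ^ 'n \<Rightarrow> real) \<Rightarrow> bool" where
  "indeterminate_bound \<alpha> f \<longleftrightarrow> BMO_seminorm f = 0 \<and> weighted_sup \<alpha> f = \<infinity>"

end

theory Submission
  imports Defs
begin

text \<open>The value of \<open>f\<close> at \<open>x\<close> differs by at most 1 from its mean over the ball of radius
  \<open>2 powi -j\<close> if \<open>2 ^ j\<close> is a suitable power of the Hoelder seminorm. The mean over the ball of
  radius \<open>2 ^ k\<close> is at most \<open>O(1)\<close> if \<open>2 ^ k\<close> is a suitable power of the weighted integral, because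
  \<open>\<alpha> < n\<close>. Doubling the radius changes the mean by at most \<open>2 ^ n\<close> times the \<open>BMO\<close> seminorm, and
  only \<open>j + k\<close> doublings, a logarithmic number, separate the two scales.\<close>

section \<open>Means over balls and the \<open>BMO\<close> seminorm\<close>

lemma measure_lebesgue_ball:
  fixes c :: "'a::euclidean_space"
  assumes "r \<ge> 0"
  shows "measure lebesgue (ball c r) = unit_ball_vol (real DIM('a)) * r ^ DIM('a)"
  using content_ball[OF assms, of c] by simp

text \<open>The left side is the absolute value of the integral of \<open>f - c\<close> over
  \<open>A\<close>. The product form also covers null sets, where both the measure and the left side
  vanish. It is applied with \<open>c\<close> a mean over a larger ball, a point value of
  \<open>f\<close>, and 0.\<close>

lemma mean_on_minus_const_le:
  fixes f :: "real ^ 'n \<Rightarrow> real"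
  assumes f: "set_integrable lebesgue A f" and A: "A \<in> lmeasurable"
    and bound: "(\<integral>\<^sup>+x\<in>A. ennreal \<bar>f x - c\<bar> \<partial>lebesgue) \<le> ennreal b" and "b \<ge> 0"
  shows "\<bar>mean_on A f - c\<bar> * measure lebesgue A \<le> b"
proof (cases "measure lebesgue A = 0")
  case False
  have c: "set_integrable lebesgue A (\<lambda>x. c)"
    using A unfolding set_integrable_def by (auto simp: fmeasurable_def)
  have fc: "set_integrable lebesgue A (\<lambda>x. f x - c)"
    using f c by (rule set_integral_diff)
  have "(LINT x:A|lebesgue. f x - c) = (LINT x:A|lebesgue. f x) - c * measure lebesgue A"
    using set_integral_diff(2)[OF f c] A unfolding set_lebesgue_integral_def
    by (simp add: fmeasurable_def mult.commute)
  also have "\<dots> = (mean_on A f - c) * measure lebesgue A"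
    using False by (simp add: mean_on_def field_simps)
  finally have "\<bar>mean_on A f - c\<bar> * measure lebesgue A = \<bar>LINT x:A|lebesgue. f x - c\<bar>"
    by (simp add: abs_mult)
  also have "ennreal \<dots> \<le> (\<integral>\<^sup>+x. ennreal (norm (indicator A x *\<^sub>R (f x - c))) \<partial>lebesgue)"
    using integral_norm_bound_ennreal[OF fc[unfolded set_integrable_def]]
    by (simp add: set_lebesgue_integral_def)
  also have "\<dots> = (\<integral>\<^sup>+x\<in>A. ennreal \<bar>f x - c\<bar> \<partial>lebesgue)"
    by (intro nn_integral_cong) (auto simp: indicator_def)
  finally show ?thesis
    using bound \<open>b \<ge> 0\<close> by (meson ennreal_le_iff order_trans)
qed (use \<open>b \<ge> 0\<close> in simp)

text \<open>Integrability over balls makes each truncation of \<open>f\<close> to a ball measurable,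
  and at every point the truncations to growing balls are eventually equal to
  \<open>f\<close>.\<close>

lemma BMO_imp_borel_measurable:
  assumes "f \<in> BMO"
  shows "f \<in> borel_measurable lebesgue"
proof (rule borel_measurable_LIMSEQ_real)
  show "(\<lambda>x. indicator (ball 0 (real i)) x *\<^sub>R f x) \<in> borel_measurable lebesgue" for i
    using assms by (auto simp: BMO_def set_integrable_def)
  show "(\<lambda>i. indicator (ball 0 (real i)) x *\<^sub>R f x) \<longlonglongrightarrow> f x" for x
  proof (rule tendsto_eventually)
    obtain N :: nat where "norm x < real N"
      using reals_Archimedean2 by blast
    then show "\<forall>\<^sub>F i in sequentially. indicator (ball 0 (real i)) x *\<^sub>R f x = f x"
      by (intro eventually_sequentiallyI[of N]) (auto simp: indicator_def)
  qed
qed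

lemma BMO_oscillation_le:
  fixes f :: "real ^ 'n \<Rightarrow> real"
  assumes "f \<in> BMO" and "r > 0"
  shows "(\<integral>\<^sup>+x\<in>ball c r. ennreal \<bar>f x - mean_on (ball c r) f\<bar> \<partial>lebesgue)
    \<le> ennreal (enn2real (BMO_seminorm f) * measure lebesgue (ball c r))"
    (is "?I \<le> _")
proof -
  let ?m = "measure lebesgue (ball c r)"
  have m: "?m > 0"
    using \<open>r > 0\<close> by (simp add: content_ball_pos)
  have e: "emeasure lebesgue (ball c r) = ennreal ?m"
    by (rule emeasure_eq_measure2) (simp add: emeasure_lborel_ball_finite)
  have "?I / ennreal ?m \<le> BMO_seminorm f"
    unfolding BMO_seminorm_def e[symmetric] using \<open>r > 0\<close> by (intro SUP_upper2[of "(c, r)"]) auto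
  then have "?I / ennreal ?m * ennreal ?m \<le> BMO_seminorm f * ennreal ?m"
    by (rule mult_right_mono) simp
  \<comment> \<open>A ball of positive radius has positive finite measure, so the division cancels
    even in \<open>ennreal\<close>.\<close>
  moreover have "?I / ennreal ?m * ennreal ?m = ?I"
    using m by (simp add: divide_ennreal_def mult.assoc ennreal_mult[symmetric] inverse_ennreal)
  moreover have "BMO_seminorm f = ennreal (enn2real (BMO_seminorm f))"
    using assms by (simp add: BMO_def)
  ultimately show ?thesis
    by (metis ennreal_mult enn2real_nonneg measure_nonneg)
qed

text \<open>The deviation from the mean over the large ball, integrated over the small ball only, is
  at most the full oscillation on the large ball. The factor \<open>2 ^ CARD('n)\<close> is the
  ratio of the volumes.\<close>

lemma mean_on_ball_double_le:
  fixes f :: "real ^ 'n \<Rightarrow> real"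
  assumes f: "f \<in> BMO" and "r > 0"
  shows "\<bar>mean_on (ball c r) f - mean_on (ball c (2 * r)) f\<bar>
    \<le> 2 ^ CARD('n) * enn2real (BMO_seminorm f)"
proof -
  let ?m = "measure lebesgue (ball c r)"
  have m: "?m > 0"
    using \<open>r > 0\<close> by (simp add: content_ball_pos)
  have m2: "measure lebesgue (ball c (2 * r)) = 2 ^ CARD('n) * ?m"
    using \<open>r > 0\<close> by (simp add: measure_lebesgue_ball power_mult_distrib del: measure_completion)
  have "(\<integral>\<^sup>+x\<in>ball c r. ennreal \<bar>f x - mean_on (ball c (2 * r)) f\<bar> \<partial>lebesgue)
    \<le> (\<integral>\<^sup>+x\<in>ball c (2 * r). ennreal \<bar>f x - mean_on (ball c (2 * r)) f\<bar> \<partial>lebesgue)"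
    using \<open>r > 0\<close> by (intro nn_integral_mono) (auto simp: indicator_def)
  also have "\<dots> \<le> ennreal (enn2real (BMO_seminorm f) * (2 ^ CARD('n) * ?m))"
    using BMO_oscillation_le[OF f, of "2 * r" c] \<open>r > 0\<close> unfolding m2 by simp
  finally have "\<bar>mean_on (ball c r) f - mean_on (ball c (2 * r)) f\<bar> * ?m
    \<le> enn2real (BMO_seminorm f) * (2 ^ CARD('n) * ?m)"
    using f by (intro mean_on_minus_const_le) (auto simp: BMO_def)
  then have "\<bar>mean_on (ball c r) f - mean_on (ball c (2 * r)) f\<bar> * ?m
    \<le> (2 ^ CARD('n) * enn2real (BMO_seminorm f)) * ?m"
    by (simp only: mult_ac)
  then show ?thesis
    using m by (simp only: mult_le_cancel_right_pos)
qed

lemma mean_on_ball_dyadic_le: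
  fixes f :: "real ^ 'n \<Rightarrow> real"
  assumes f: "f \<in> BMO" and "r > 0"
  shows "\<bar>mean_on (ball c r) f - mean_on (ball c (2 ^ i * r)) f\<bar>
    \<le> real i * (2 ^ CARD('n) * enn2real (BMO_seminorm f))"
proof (induction i)
  case (Suc i)
  have "\<bar>mean_on (ball c (2 ^ i * r)) f - mean_on (ball c (2 ^ Suc i * r)) f\<bar>
    \<le> 2 ^ CARD('n) * enn2real (BMO_seminorm f)"
    using mean_on_ball_double_le[OF f, of "2 ^ i * r" c] \<open>r > 0\<close> by (simp add: mult.assoc)
  with Suc show ?case
    unfolding of_nat_Suc distrib_right by linarith
qed simp

section \<open>Means at the small and at the large scale\<close>

lemma holder_increment_le:
  fixes f :: "real ^ 'n \<Rightarrow> real"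
  assumes f: "f \<in> holder_space \<eta>"
  shows "\<bar>f x - f y\<bar> \<le> enn2real (holder_seminorm \<eta> f) * norm (x - y) powr \<eta>"
proof (cases "x = y")
  case False
  have "ennreal (\<bar>f x - f y\<bar> / norm (x - y) powr \<eta>) \<le> holder_seminorm \<eta> f"
    unfolding holder_seminorm_def using False by (intro SUP_upper2[of "(x, y)"]) auto
  also have "\<dots> = ennreal (enn2real (holder_seminorm \<eta> f))"
    using f by (simp add: holder_space_def)
  finally show ?thesis
    using False by (simp add: divide_le_eq)
qed simp

lemma holder_mean_on_ball_le:
  fixes f :: "real ^ 'n \<Rightarrow> real"
  assumes f: "f \<in> holder_space \<eta>" "f \<in> BMO" and "r > 0" "\<eta> > 0"
  shows "\<bar>mean_on (ball x r) f - f x\<bar> \<le> enn2real (holder_seminorm \<eta> f) * r powr \<eta>"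
proof -
  let ?m = "measure lebesgue (ball x r)"
  let ?h = "enn2real (holder_seminorm \<eta> f) * r powr \<eta>"
  have m: "?m > 0"
    using \<open>r > 0\<close> by (simp add: content_ball_pos)
  have "\<bar>f y - f x\<bar> \<le> ?h" if "y \<in> ball x r" for y
  proof -
    have "norm (y - x) powr \<eta> \<le> r powr \<eta>"
      using that \<open>\<eta> > 0\<close> by (intro powr_mono2) (auto simp: dist_norm norm_minus_commute)
    then show ?thesis
      using holder_increment_le[OF f(1), of y x] mult_left_mono enn2real_nonneg order_trans by metis
  qed
  then have "(\<integral>\<^sup>+y\<in>ball x r. ennreal \<bar>f y - f x\<bar> \<partial>lebesgue)
    \<le> (\<integral>\<^sup>+y\<in>ball x r. ennreal ?h \<partial>lebesgue)"
    by (intro nn_integral_mono) (auto simp: indicator_def intro!: ennreal_leI)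
  also have "\<dots> = ennreal (?h * ?m)"
  proof -
    have "emeasure lebesgue (ball x r) = ennreal ?m"
      by (rule emeasure_eq_measure2) (simp add: emeasure_lborel_ball_finite)
    then show ?thesis
      by (subst nn_integral_cmult_indicator) (auto simp: ennreal_mult)
  qed
  finally have "\<bar>mean_on (ball x r) f - f x\<bar> * ?m \<le> ?h * ?m"
    using f by (intro mean_on_minus_const_le) (auto simp: BMO_def)
  then show ?thesis
    using m by (simp only: mult_le_cancel_right_pos)
qed

text \<open>On the ball, \<open>norm (x - y) + 1\<close> is at most \<open>2 * R\<close> because
  \<open>R\<close> \<ge> 1, so the integral of \<bar>f\<bar> is at most
  \<open>(2 * R) powr \<alpha>\<close> times the weighted one. Dividing by the volume leaves
  \<open>R\<close> to the power \<alpha> - n, which decays when \<alpha> < n.\<close>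

lemma weighted_mean_on_ball_le:
  fixes f :: "real ^ 'n \<Rightarrow> real"
  assumes f: "f \<in> BMO" and w: "weighted_sup \<alpha> f < \<infinity>" and "R \<ge> 1" "\<alpha> > 0"
  shows "\<bar>mean_on (ball x R) f\<bar>
    \<le> 2 powr \<alpha> / unit_ball_vol (real CARD('n)) * enn2real (weighted_sup \<alpha> f)
       * R powr (\<alpha> - real CARD('n))"
proof -
  let ?m = "measure lebesgue (ball x R)"
  let ?w = "enn2real (weighted_sup \<alpha> f)"
  \<comment> \<open>The subtracted 0 matches the form of \<open>mean_on_minus_const_le\<close> with
    \<open>c = 0\<close>.\<close>
  have wt: "ennreal \<bar>f y - 0\<bar> * indicator (ball x R) y
    \<le> ennreal ((2 * R) powr \<alpha>) * ennreal (\<bar>f y\<bar> / (norm (x - y) + 1) powr \<alpha>)" for y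
  proof (cases "y \<in> ball x R")
    case True
    have "(norm (x - y) + 1) powr \<alpha> \<le> (2 * R) powr \<alpha>"
      using True assms by (intro powr_mono2) (auto simp: dist_norm)
    moreover have "(norm (x - y) + 1) powr \<alpha> > 0"
      using norm_ge_zero[of "x - y"] by (auto simp del: norm_ge_zero)
    ultimately have "\<bar>f y\<bar> \<le> (2 * R) powr \<alpha> * (\<bar>f y\<bar> / (norm (x - y) + 1) powr \<alpha>)"
      by (simp add: le_divide_eq mult.commute mult_left_mono)
    then show ?thesis
      using True by (simp add: ennreal_mult[symmetric] ennreal_leI)
  qed simp
  have meas: "(\<lambda>y. ennreal (\<bar>f y\<bar> / (norm (x - y) + 1) powr \<alpha>)) \<in> borel_measurable lebesgue"
  proof -
    have "(\<lambda>y. (norm (x - y) + 1) powr \<alpha>) \<in> borel_measurable lebesgue"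
      by (rule measurable_completion) simp
    with BMO_imp_borel_measurable[OF f] show ?thesis
      by measurable
  qed
  have "(\<integral>\<^sup>+y\<in>ball x R. ennreal \<bar>f y - 0\<bar> \<partial>lebesgue)
    \<le> ennreal ((2 * R) powr \<alpha>) * (\<integral>\<^sup>+y. ennreal (\<bar>f y\<bar> / (norm (x - y) + 1) powr \<alpha>) \<partial>lebesgue)"
    unfolding nn_integral_cmult[OF meas, symmetric] by (intro nn_integral_mono wt)
  also have "\<dots> \<le> ennreal ((2 * R) powr \<alpha>) * weighted_sup \<alpha> f"
    unfolding weighted_sup_def by (intro mult_left_mono SUP_upper) auto
  also have "weighted_sup \<alpha> f = ennreal ?w"
    using w by simp
  also have "ennreal ((2 * R) powr \<alpha>) * ennreal ?w = ennreal ((2 * R) powr \<alpha> * ?w)"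
    by (simp add: ennreal_mult)
  finally have "\<bar>mean_on (ball x R) f - 0\<bar> * ?m \<le> (2 * R) powr \<alpha> * ?w"
    using f by (intro mean_on_minus_const_le) (auto simp: BMO_def)
  moreover have "?m = unit_ball_vol (real CARD('n)) * R powr real CARD('n)"
    using \<open>R \<ge> 1\<close> by (simp add: measure_lebesgue_ball powr_realpow del: measure_completion)
  ultimately show ?thesis
    using \<open>R \<ge> 1\<close> unit_ball_vol_pos[of "real CARD('n)"]
    by (simp add: powr_mult powr_diff field_simps)
qed

section \<open>Choice of the scales and the pointwise bound\<close>

lemma dyadic_exponent_exists:
  fixes t p :: real
  assumes "p > 0"
  obtains j :: nat where "t \<le> (2 ^ j) powr p" and "real j \<le> 1 + ln (max 1 t) / (p * ln 2)"
proof
  \<comment> \<open>\<open>?s\<close> is the real exponent at which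
    \<open>(2 powr ?s) powr p\<close> equals \<open>max 1 t\<close>; rounding up costs at most 1.
    The maximum with 1 makes \<open>?s\<close> nonnegative, so \<open>nat\<close> truncates
    nothing.\<close>
  let ?s = "ln (max 1 t) / (p * ln 2)"
  let ?j = "nat \<lceil>?s\<rceil>"
  have s: "?s \<ge> 0"
    using assms by simp
  then show "real ?j \<le> 1 + ?s"
    by linarith
  have "?s \<le> real ?j"
    by linarith
  then have "ln (max 1 t) \<le> real ?j * (p * ln 2)"
    using assms by (subst (asm) pos_divide_le_eq) auto
  also have "\<dots> = ln ((2 ^ ?j) powr p)"
    by (simp add: ln_powr ln_realpow)
  finally have "max 1 t \<le> (2 ^ ?j) powr p"
    by (subst (asm) ln_le_cancel_iff) auto
  then show "t \<le> (2 ^ ?j) powr p"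
    by simp
qed

text \<open>All three quantities are finite here, so \<open>enn2real\<close> loses nothing. The path
  from \<open>f x\<close> through the means at the two scales to 0 costs 1, then
  \<open>j + k\<close> doublings, then the constant with \<open>unit_ball_vol\<close>. The summand 2
  in the last factor comes from rounding up both exponents.\<close>

lemma BMO_logarithmic_bound:
  fixes f :: "real ^ 'n \<Rightarrow> real" and \<alpha> \<eta> :: real
  defines "b \<equiv> enn2real (BMO_seminorm f)"
    and "M \<equiv> enn2real (weighted_sup \<alpha> f) + enn2real (holder_seminorm \<eta> f)"
  assumes f: "f \<in> holder_space \<eta>" "f \<in> BMO" and w: "weighted_sup \<alpha> f < \<infinity>"
    and \<eta>: "\<eta> > 0" and \<alpha>: "0 < \<alpha>" "\<alpha> < real CARD('n)"
  shows "\<bar>f x\<bar> \<le> 1 + 2 powr \<alpha> / unit_ball_vol (real CARD('n))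
    + 2 ^ CARD('n) * b * (2 + (1 / \<eta> + 1 / (real CARD('n) - \<alpha>)) / ln 2 * ln (max 1 M))"
proof -
  let ?n = "real CARD('n)"
  let ?w = "enn2real (weighted_sup \<alpha> f)"
  let ?h = "enn2real (holder_seminorm \<eta> f)"
  let ?L = "ln (max 1 M)"
  obtain j where j: "?h \<le> (2 ^ j) powr \<eta>" "real j \<le> 1 + ln (max 1 ?h) / (\<eta> * ln 2)"
    using dyadic_exponent_exists \<eta> .
  obtain k where k: "?w \<le> (2 ^ k) powr (?n - \<alpha>)"
    "real k \<le> 1 + ln (max 1 ?w) / ((?n - \<alpha>) * ln 2)"
    using dyadic_exponent_exists \<alpha>(2) diff_gt_0_iff_gt by metis
  \<comment> \<open>Starting at radius \<open>1 / 2 ^ j\<close>, exactly \<open>j + k\<close>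
    doublings reach \<open>2 ^ k\<close>, which is at least 1 as the weighted estimate
    demands.\<close>
  define r :: real where "r = 1 / 2 ^ j"
  have r: "r > 0" and R: "2 ^ (j + k) * r = 2 ^ k"
    by (auto simp: r_def power_add)
  have "\<bar>mean_on (ball x r) f - f x\<bar> \<le> ?h * r powr \<eta>"
    using f r \<eta> by (rule holder_mean_on_ball_le)
  also have "\<dots> \<le> 1"
    using j(1) by (simp add: r_def powr_divide divide_le_eq)
  finally have 1: "\<bar>mean_on (ball x r) f - f x\<bar> \<le> 1" .
  have 2: "\<bar>mean_on (ball x r) f - mean_on (ball x (2 ^ k)) f\<bar> \<le> real (j + k) * (2 ^ CARD('n) * b)"
    using mean_on_ball_dyadic_le[OF f(2) r, of x "j + k"] unfolding R b_def .
  have "?w * (2 ^ k) powr (\<alpha> - ?n) \<le> (2 ^ k) powr (?n - \<alpha>) * (2 ^ k) powr (\<alpha> - ?n)"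
    using k(1) by (rule mult_right_mono) simp
  also have "\<dots> = 1"
    by (simp add: powr_add[symmetric])
  finally have "2 powr \<alpha> / unit_ball_vol ?n * (?w * (2 ^ k) powr (\<alpha> - ?n))
    \<le> 2 powr \<alpha> / unit_ball_vol ?n * 1"
    by (rule mult_left_mono) simp
  then have 3: "\<bar>mean_on (ball x (2 ^ k)) f\<bar> \<le> 2 powr \<alpha> / unit_ball_vol ?n"
    using weighted_mean_on_ball_le[OF f(2) w, of "2 ^ k" x] \<alpha>(1) by (simp add: mult.assoc)
  \<comment> \<open>\<open>M\<close> dominates both seminorms, so a single logarithm bounds both
    exponents and their coefficients add up.\<close>
  have "?h \<le> M" "?w \<le> M"
    by (simp_all add: M_def)
  then have "ln (max 1 ?h) \<le> ?L" "ln (max 1 ?w) \<le> ?L"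
    by (auto intro!: ln_mono max.mono)
  then have "ln (max 1 ?h) / (\<eta> * ln 2) \<le> ?L / (\<eta> * ln 2)"
    using \<eta> by (intro divide_right_mono) auto
  moreover from \<open>ln (max 1 ?w) \<le> ?L\<close>
  have "ln (max 1 ?w) / ((?n - \<alpha>) * ln 2) \<le> ?L / ((?n - \<alpha>) * ln 2)"
    using \<alpha> by (intro divide_right_mono) auto
  moreover have "(1 / \<eta> + 1 / (?n - \<alpha>)) / ln 2 * ?L = ?L / (\<eta> * ln 2) + ?L / ((?n - \<alpha>) * ln 2)"
    by (simp add: add_divide_distrib distrib_right)
  ultimately have "real (j + k) \<le> 2 + (1 / \<eta> + 1 / (?n - \<alpha>)) / ln 2 * ?L"
    using j(2) k(2) by simp
  then have "2 ^ CARD('n) * b * real (j + k)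
    \<le> 2 ^ CARD('n) * b * (2 + (1 / \<eta> + 1 / (?n - \<alpha>)) / ln 2 * ?L)"
    by (rule mult_left_mono) (simp add: b_def)
  with 1 2 3 show ?thesis
    unfolding mult.commute[of "real (j + k)"] by linarith
qed

section \<open>From real bounds to the estimate in \<open>ennreal\<close>\<close>

lemma log_plus_ennreal:
  assumes "s \<ge> 0"
  shows "log_plus (ennreal s) = ennreal (ln (max 1 s))"
  using assms by (auto simp: log_plus_def max_def)

theorem theorem1p1:
  fixes \<eta> \<alpha> :: real
  assumes "0 < \<eta>" and "\<eta> < 1"
    and "0 < \<alpha>" and "\<alpha> < real CARD('n::finite)"
  shows "\<exists>C::real. C > 0 \<and>
    (\<forall>f :: real ^ 'n \<Rightarrow> real. f \<in> holder_space \<eta> \<inter> BMO \<longrightarrow> \<not> indeterminate_bound \<alpha> f \<longrightarrow>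
      Linfty_norm f \<le> ennreal C + ennreal C * BMO_seminorm f *
        (1 + log_plus (weighted_sup \<alpha> f + holder_seminorm \<eta> f)))"
proof (intro exI conjI allI impI)
  define K where "K = (1 / \<eta> + 1 / (real CARD('n) - \<alpha>)) / ln 2"
  define D where "D = 1 + 2 powr \<alpha> / unit_ball_vol (real CARD('n))"
  \<comment> \<open>As a sum of nonnegative terms, \<open>C\<close> dominates both the additive
    constant \<open>D\<close> and the coefficient \<open>2 ^ CARD('n) * (2 + K)\<close>. It depends
    on n, \<eta> and \<alpha>, but not on \<open>f\<close>.\<close>
  define C where "C = D + 2 ^ CARD('n) * (2 + K)"
  have K: "K \<ge> 0" and D: "D > 0"
    using assms by (auto simp: K_def D_def intro!: add_pos_nonneg)
  then show "C > 0"
    by (auto simp: C_def intro!: add_pos_nonneg)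
  fix f :: "real ^ 'n \<Rightarrow> real"
  assume "f \<in> holder_space \<eta> \<inter> BMO" and nind: "\<not> indeterminate_bound \<alpha> f"
  then have f: "f \<in> holder_space \<eta>" "f \<in> BMO"
    by auto
  let ?rhs = "ennreal C + ennreal C * BMO_seminorm f *
        (1 + log_plus (weighted_sup \<alpha> f + holder_seminorm \<eta> f))"
  show "Linfty_norm f \<le> ?rhs"
  proof (cases "weighted_sup \<alpha> f = \<infinity>")
    \<comment> \<open>Here \<open>log_plus\<close> is infinite. Excluding the indeterminate case
      makes its factor nonzero, so the product is infinite rather than 0.\<close>
    case True
    then have "BMO_seminorm f \<noteq> 0"
      using nind by (simp add: indeterminate_bound_def)
    then have "?rhs = \<infinity>"
      using True \<open>C > 0\<close> by (simp add: log_plus_def ennreal_mult_top ennreal_mult_eq_top_iff)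
    then show ?thesis
      by simp
  next
    case False
    define b where "b = enn2real (BMO_seminorm f)"
    define M where "M = enn2real (weighted_sup \<alpha> f) + enn2real (holder_seminorm \<eta> f)"
    have b: "BMO_seminorm f = ennreal b" "b \<ge> 0"
      using f by (auto simp: b_def BMO_def)
    have M: "weighted_sup \<alpha> f + holder_seminorm \<eta> f = ennreal M" "M \<ge> 0"
      using f False by (auto simp: M_def holder_space_def less_top)
    have rhs: "?rhs = ennreal (C + C * b * (1 + ln (max 1 M)))"
      using b M \<open>C > 0\<close> by (simp add: log_plus_ennreal ennreal_mult ennreal_plus)
    have "\<bar>f x\<bar> \<le> C + C * b * (1 + ln (max 1 M))" for x
    proof -
      let ?L = "ln (max 1 M)"
      have "\<bar>f x\<bar> \<le> D + 2 ^ CARD('n) * b * (2 + K * ?L)"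
        using BMO_logarithmic_bound[OF f, of \<alpha> x] False assms
        by (simp add: D_def K_def b_def M_def less_top)
      \<comment> \<open>Since \<open>max 1 M\<close> \<ge> 1, \<open>?L\<close> is nonnegative;
        expanding the right-hand product then only adds nonnegative terms.\<close>
      also have "2 ^ CARD('n) * b * (2 + K * ?L) \<le> 2 ^ CARD('n) * b * ((2 + K) * (1 + ?L))"
        using K b(2) by (intro mult_left_mono) (auto simp: algebra_simps)
      also have "\<dots> = (2 ^ CARD('n) * (2 + K)) * (b * (1 + ?L))"
        by (simp only: mult_ac)
      also have "\<dots> \<le> C * (b * (1 + ?L))"
        using D b(2) by (intro mult_right_mono) (auto simp: C_def)
      also have "D \<le> C"
        using K by (simp add: C_def)
      finally show ?thesis
        by (simp add: mult.assoc)
    qed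
    \<comment> \<open>The bound holds at every point, hence almost everywhere;
      \<open>esssup_I\<close> also asks for measurability of \<open>f\<close>.\<close>
    then show ?thesis
      unfolding Linfty_norm_def rhs using BMO_imp_borel_measurable[OF f(2)]
      by (intro esssup_I) (auto intro!: ennreal_leI)
  qed
qed

end
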